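(* Let $\Phi:\mathbb{R}^n\to 2^{\mathbb{R}^n}$ be a set-valued mapping with nonempty, closed and convex values, and let $f:\mathbb{R}^n\to\mathbb{R}^n$ be a single-valued mapping. Let $\sigma>0$, $\gamma>2$, $\alpha>0$. Then $u^*\in\mathbb{R}^n$ is a solution of the inverse quasi-variational inequality problem associated with $(f,\Phi)$ if and only if $u^*$ is an equilibrium point of the dynamical system $$\dot u(t)=-\sigma\,\frac{f(u)-P_{\Phi(u)}(f(u)-\alpha u)}{\|f(u)-P_{\Phi(u)}(f(u)-\alpha u)\|^{\frac{\gamma-2}{\gamma-1}}},\qquad u=u(t).$$
   Context: $P_C(u)$ is the metric projection of $u\in\mathbb{R}^n$ onto a nonempty closed convex set $C$. Inverse quasi-variational inequality problem associated with $(f,\Phi)$: find $u^*\in\mathbb{R}^n$ such that $f(u^* )\in\Phi(u^* )$ and $\langle u^*,y-f(u^* )\rangle\ge 0$ for all $y\in\Phi(u^* )$. An equilibrium point of a dynamical system is a point at which the right-hand side vanishes. The right-hand side of the system above is understood to be $0$ at points $u$ with $f(u)-P_{\Phi(u)}(f(u)-\alpha u)=0$. *)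

theory Defs
  imports "HOL-Analysis.Analysis"
begin

text \<open>The inverse quasi-variational inequality (IQVI) problem: in contrast to the direct one, it is
  \<^term>\<open>f u\<close>, not \<^term>\<open>u\<close>, that is constrained to \<^term>\<open>\<Phi> u\<close>.\<close>

definition solves_iqvi ::
  "('a::real_inner \<Rightarrow> 'a) \<Rightarrow> ('a \<Rightarrow> 'a set) \<Rightarrow> 'a \<Rightarrow> bool" where
  "solves_iqvi f \<Phi> u \<longleftrightarrow> f u \<in> \<Phi> u \<and> (\<forall>y\<in>\<Phi> u. u \<bullet> (y - f u) \<ge> 0)"

text \<open>The metric projection onto a nonempty closed convex set is \<^const>\<open>closest_point\<close>.\<close>

definition proj_residual ::
  "('a::euclidean_space \<Rightarrow> 'a) \<Rightarrow> ('a \<Rightarrow> 'a set) \<Rightarrow> real \<Rightarrow> 'a \<Rightarrow> 'a" where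
  "proj_residual f \<Phi> \<alpha> u = f u - closest_point (\<Phi> u) (f u - \<alpha> *\<^sub>R u)"

text \<open>Right-hand side of the autonomous system. The quotient is not defined where the
  residual vanishes; the system is understood to have right-hand side 0 there.\<close>

definition system_rhs ::
  "('a::euclidean_space \<Rightarrow> 'a) \<Rightarrow> ('a \<Rightarrow> 'a set) \<Rightarrow> real \<Rightarrow> real \<Rightarrow> real \<Rightarrow> 'a \<Rightarrow> 'a" where
  "system_rhs f \<Phi> \<sigma> \<gamma> \<alpha> u =
    (if proj_residual f \<Phi> \<alpha> u = 0 then 0
     else - (\<sigma> *\<^sub>R (proj_residual f \<Phi> \<alpha> u
                 /\<^sub>R (norm (proj_residual f \<Phi> \<alpha> u) powr ((\<gamma> - 2) / (\<gamma> - 1))))))"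

definition equilibrium_point :: "('a::real_vector \<Rightarrow> 'a) \<Rightarrow> 'a \<Rightarrow> bool" where
  "equilibrium_point F u \<longleftrightarrow> F u = 0"

end

theory Submission
  imports Defs
begin

text \<open>
  Both properties of \<open>u\<close> say that \<open>f u\<close> is the projection of \<open>f u - \<alpha> *\<^sub>R u\<close> onto the set
  \<open>\<Phi> u\<close>. The obtuse-angle criterion describes a projection \<open>p\<close> of \<open>a\<close> by
  \<open>(p - a) \<bullet> (y - p) \<ge> 0\<close> for all \<open>y\<close> in the set. For \<open>p = f u\<close> the difference \<open>p - a\<close> is
  \<open>\<alpha> *\<^sub>R u\<close>, and the positive factor \<open>\<alpha>\<close> does not affect the sign, so the criterion becomes the
  variational inequality. Thus solutions are the zeros of the residual
  (\<open>solves_iqvi_iff_proj_residual_eq_0\<close>). Away from these zeros the right-hand side of the system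
  is a nonzero multiple of the residual, so it creates no further equilibria
  (\<open>system_rhs_eq_0_iff\<close>).
\<close>

text \<open>
  The obtuse-angle criterion for the metric projection. For the converse direction, a point \<open>p\<close>
  with this property satisfies \<open>(dist a y)\<^sup>2 = (dist a p)\<^sup>2 + 2 * ((p - a) \<bullet> (y - p)) + (dist p y)\<^sup>2\<close>,
  so no point of the set is closer to \<open>a\<close>, and the closest point of a convex set is unique.
\<close>

lemma closest_point_eq_iff_inner:
  fixes S :: "'a::euclidean_space set"
  assumes "S \<noteq> {}" "closed S" "convex S"
  shows "closest_point S a = p \<longleftrightarrow> p \<in> S \<and> (\<forall>y\<in>S. (p - a) \<bullet> (y - p) \<ge> 0)"
proof
  assume p: "closest_point S a = p"
  have "(p - a) \<bullet> (y - p) \<ge> 0" if "y \<in> S" for y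
    using closest_point_dot[OF \<open>convex S\<close> \<open>closed S\<close> that, of a] p
    by (simp add: inner_diff_left)
  then show "p \<in> S \<and> (\<forall>y\<in>S. (p - a) \<bullet> (y - p) \<ge> 0)"
    using closest_point_in_set[OF \<open>closed S\<close> \<open>S \<noteq> {}\<close>] p by blast
next
  assume p: "p \<in> S \<and> (\<forall>y\<in>S. (p - a) \<bullet> (y - p) \<ge> 0)"
  have "dist a p \<le> dist a y" if "y \<in> S" for y
  proof -
    have "(dist a y)\<^sup>2 = (dist a p)\<^sup>2 + 2 * ((p - a) \<bullet> (y - p)) + (dist p y)\<^sup>2"
      by (simp add: dist_norm power2_norm_eq_inner inner_diff_left inner_diff_right inner_commute)
    then have "(dist a p)\<^sup>2 \<le> (dist a y)\<^sup>2"
      using p that by simp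
    then show ?thesis
      by (rule power2_le_imp_le) simp
  qed
  then show "closest_point S a = p"
    using closest_point_unique[OF \<open>convex S\<close> \<open>closed S\<close>] p by metis
qed

lemma solves_iqvi_iff_proj_residual_eq_0:
  fixes f :: "'a::euclidean_space \<Rightarrow> 'a"
  assumes "\<Phi> u \<noteq> {}" "closed (\<Phi> u)" "convex (\<Phi> u)" "\<alpha> > 0"
  shows "solves_iqvi f \<Phi> u \<longleftrightarrow> proj_residual f \<Phi> \<alpha> u = 0"
proof -
  have "proj_residual f \<Phi> \<alpha> u = 0 \<longleftrightarrow> closest_point (\<Phi> u) (f u - \<alpha> *\<^sub>R u) = f u"
    by (auto simp: proj_residual_def)
  also have "\<dots> \<longleftrightarrow> f u \<in> \<Phi> u \<and> (\<forall>y\<in>\<Phi> u. \<alpha> * (u \<bullet> (y - f u)) \<ge> 0)"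
    by (simp add: closest_point_eq_iff_inner[OF assms(1-3)])
  also have "\<dots> \<longleftrightarrow> solves_iqvi f \<Phi> u"
    using \<open>\<alpha> > 0\<close> by (simp add: solves_iqvi_def zero_le_mult_iff)
  finally show ?thesis by simp
qed

lemma system_rhs_eq_0_iff:
  assumes "\<sigma> \<noteq> 0"
  shows "system_rhs f \<Phi> \<sigma> \<gamma> \<alpha> u = 0 \<longleftrightarrow> proj_residual f \<Phi> \<alpha> u = 0"
  using assms by (simp add: system_rhs_def)

theorem corollary3p1:
  fixes \<Phi> :: "real ^ 'n \<Rightarrow> (real ^ 'n) set"
    and f :: "real ^ 'n \<Rightarrow> real ^ 'n"
    and \<sigma> \<gamma> \<alpha> :: real
    and u :: "real ^ 'n"
  assumes "\<And>x. \<Phi> x \<noteq> {}"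
    and "\<And>x. closed (\<Phi> x)"
    and "\<And>x. convex (\<Phi> x)"
    and "\<sigma> > 0" and "\<gamma> > 2" and "\<alpha> > 0"
  shows "solves_iqvi f \<Phi> u \<longleftrightarrow> equilibrium_point (system_rhs f \<Phi> \<sigma> \<gamma> \<alpha>) u"
  using assms by (simp add: equilibrium_point_def system_rhs_eq_0_iff
      solves_iqvi_iff_proj_residual_eq_0[where \<alpha> = \<alpha>])

end
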